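(* Let $T$ and $d$ be integers with $1\le d\le T$, and let $X=\{x\in\mathbb{R}^d:\|x\|_2\le 1\}$ be the Euclidean unit ball. There exist a convex function $f:X\to\mathbb{R}$ that is $3$-Lipschitz and $1$-strongly convex and has $0$ as a global minimizer over $X$, and a (deterministic) sub-gradient oracle for $f$, such that the iterates of projected sub-gradient descent on $f$ with this oracle, initial point $x_1=0$ and step sizes $\eta_t=1/t$, i.e. $x_{t+1}=\Pi_X(x_t-\eta_t\hat g_t)$ with $\hat g_t\in\partial f(x_t)$ the vector returned by the oracle at step $t$ ($t=1,\dots,T$), satisfy $$f(x_{T+1})-\min_{x\in X}f(x)\ \ge\ \frac{\log d}{5T}.$$
   Context: $\Pi_X$ denotes Euclidean projection onto $X$. For a convex function $f:X\to\mathbb{R}$ and $x\in X$, $\partial f(x)$ is the set of $g\in\mathbb{R}^d$ with $f(x')-f(x)\ge g^\top(x'-x)$ for all $x'\in X$. $f$ is $\alpha$-strongly convex if $f(y)-f(x)\ge g^\top(y-x)+\frac{\alpha}{2}\|y-x\|_2^2$ for all $x,y\in X$ and $g\in\partial f(x)$. $f$ is $L$-Lipschitz if $|f(x)-f(y)|\le L\|x-y\|_2$ for all $x,y\in X$. A deterministic sub-gradient oracle returns, at each step $t$, some element of $\partial f(x_t)$ at the current iterate $x_t$; the choice may depend on the step index $t$ as well as on $x_t$. $\log$ is the natural logarithm. *)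

theory Defs
  imports "HOL-Analysis.Analysis"
begin

(* A function f : X \<rightarrow> \<real> is represented by a total function; every notion below only uses
   its values on X.  In particular the subdifferential is relative to X: the subgradient inequality
   is only required against points of X. *)

definition subdifferential :: "'a::real_inner set \<Rightarrow> ('a \<Rightarrow> real) \<Rightarrow> 'a \<Rightarrow> 'a set" where
  "subdifferential X f x = {g. \<forall>x'\<in>X. f x' - f x \<ge> g \<bullet> (x' - x)}"

definition strongly_convex_on :: "real \<Rightarrow> 'a::real_inner set \<Rightarrow> ('a \<Rightarrow> real) \<Rightarrow> bool" where
  "strongly_convex_on \<alpha> X f \<longleftrightarrow>
     (\<forall>x\<in>X. \<forall>y\<in>X. \<forall>g\<in>subdifferential X f x.
        f y - f x \<ge> g \<bullet> (y - x) + \<alpha> / 2 * (norm (y - x))\<^sup>2)"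

(* G t x is the vector returned at step t when the current iterate is x. *)

definition subgradient_oracle ::
    "'a::real_inner set \<Rightarrow> ('a \<Rightarrow> real) \<Rightarrow> (nat \<Rightarrow> 'a \<Rightarrow> 'a) \<Rightarrow> bool" where
  "subgradient_oracle X f G \<longleftrightarrow> (\<forall>t\<ge>1. \<forall>x\<in>X. G t x \<in> subdifferential X f x)"

(* Steps and iterates are numbered from 1: psgd X G \<eta> x1 t is the iterate x_t for t \<ge> 1.
   The index 0 is not used; its value is a dummy. *)

fun psgd ::
    "'a::euclidean_space set \<Rightarrow> (nat \<Rightarrow> 'a \<Rightarrow> 'a) \<Rightarrow> (nat \<Rightarrow> real) \<Rightarrow> 'a \<Rightarrow> nat \<Rightarrow> 'a" where
  "psgd X G \<eta> x1 0 = x1"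
| "psgd X G \<eta> x1 (Suc 0) = x1"
| "psgd X G \<eta> x1 (Suc (Suc n)) =
     (let t = Suc n; x = psgd X G \<eta> x1 t in closest_point X (x - \<eta> t *\<^sub>R G t x))"

end

theory Submission
  imports Defs
begin

text \<open>
  Take \<open>f x = Max\<^sub>i (h i \<bullet> x) + (norm x)\<^sup>2 / 2\<close> for finitely many vectors \<open>h i\<close>. With step sizes
  \<open>1 / t\<close> and answers \<open>h i + x\<close>, the quadratic term makes \<open>t *\<^sub>R x\<^sub>t\<^sub>+\<^sub>1\<close> equal to minus the sum of
  the vectors \<open>h i\<close> chosen so far. Since \<open>h 0 = 0\<close>, the oracle can idle at the origin for \<open>T - d\<close>
  steps; it then answers with \<open>h 1, \<dots>, h d\<close>, where \<open>h i\<close> has entry \<open>-1\<close> at coordinate \<open>i\<close> and the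
  small positive entry \<open>a m = 1 / (2 (d + 1 - m))\<close> at each coordinate \<open>m < i\<close>. All coordinates of
  the iterate stay nonnegative, so the next unused vector is always active, and in the end every
  coordinate is at least \<open>1 / (2 T)\<close>. The remaining vector \<open>h (d + 1)\<close>, whose entries are all the
  \<open>a m\<close>, then gives a value of at least \<open>(\<Sum>m. a m) / (2 T)\<close>, a harmonic sum.
\<close>

section \<open>Strong convexity\<close>

lemma norm_convex_combination_square:
  fixes x y :: "'a::real_inner"
  shows "(norm ((1 - s) *\<^sub>R x + s *\<^sub>R y))\<^sup>2
    = (1 - s) * (norm x)\<^sup>2 + s * (norm y)\<^sup>2 - s * (1 - s) * (norm (y - x))\<^sup>2"
  unfolding power2_norm_eq_inner
  by (simp add: inner_add_left inner_add_right inner_diff_left inner_diff_right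
      inner_commute algebra_simps power2_eq_square)

text \<open>Testing \<open>g\<close> at the point of parameter \<open>s\<close> on the segment and
  using convexity of the remainder yields the claim with its quadratic term scaled by
  \<open>1 - s\<close>; then \<open>s\<close> tends to \<open>0\<close>.\<close>

lemma strongly_convex_onI:
  fixes f :: "'a::real_inner \<Rightarrow> real"
  assumes "convex_on X (\<lambda>x. f x - \<alpha> / 2 * (norm x)\<^sup>2)"
  shows "strongly_convex_on \<alpha> X f"
  unfolding strongly_convex_on_def
proof (intro ballI)
  fix x y g
  assume x: "x \<in> X" and y: "y \<in> X" and g: "g \<in> subdifferential X f x"
  define B where "B = \<alpha> / 2 * (norm (y - x))\<^sup>2"
  have X: "convex X"
    using assms by (simp add: convex_on_def)
  have *: "g \<bullet> (y - x) + (1 - s) * B \<le> f y - f x" if s: "0 < s" "s < 1" for s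
  proof -
    define z where "z = (1 - s) *\<^sub>R x + s *\<^sub>R y"
    have z: "z \<in> X"
      unfolding z_def using X x y s by (simp add: convex_alt)
    have zx: "z - x = s *\<^sub>R (y - x)"
      unfolding z_def by (simp add: algebra_simps)
    have 1: "s * (g \<bullet> (y - x)) \<le> f z - f x"
      using g z unfolding subdifferential_def by (auto simp: zx dest: bspec[of _ _ z])
    have 2: "f z - \<alpha> / 2 * (norm z)\<^sup>2
        \<le> (1 - s) * (f x - \<alpha> / 2 * (norm x)\<^sup>2) + s * (f y - \<alpha> / 2 * (norm y)\<^sup>2)"
      unfolding z_def using convex_onD[OF assms, of s x y] x y s by simp
    have 3: "(norm z)\<^sup>2 = (1 - s) * (norm x)\<^sup>2 + s * (norm y)\<^sup>2 - s * (1 - s) * (norm (y - x))\<^sup>2"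
      unfolding z_def by (rule norm_convex_combination_square)
    have "s * (g \<bullet> (y - x) + (1 - s) * B) \<le> s * (f y - f x)"
      using 1 2 unfolding 3 B_def by (simp add: field_simps)
    then show ?thesis
      using s by simp
  qed
  have "((\<lambda>s. g \<bullet> (y - x) + (1 - s) * B) \<longlongrightarrow> g \<bullet> (y - x) + (1 - 0) * B) (at_right 0)"
    by (intro tendsto_intros)
  moreover have "eventually (\<lambda>s. g \<bullet> (y - x) + (1 - s) * B \<le> f y - f x) (at_right 0)"
    unfolding eventually_at_right_field using * by (intro exI[of _ 1]) auto
  ultimately have "g \<bullet> (y - x) + (1 - 0) * B \<le> f y - f x"
    by (intro tendsto_upperbound) auto
  then show "f y - f x \<ge> g \<bullet> (y - x) + \<alpha> / 2 * (norm (y - x))\<^sup>2"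
    by (simp add: B_def)
qed

section \<open>Maxima of linear functionals plus a quadratic\<close>

definition max_linear :: "'i set \<Rightarrow> ('i \<Rightarrow> 'a::real_inner) \<Rightarrow> 'a \<Rightarrow> real" where
  "max_linear I h x = Max ((\<lambda>i. h i \<bullet> x) ` I)"

definition max_quadratic :: "'i set \<Rightarrow> ('i \<Rightarrow> 'a::real_inner) \<Rightarrow> 'a \<Rightarrow> real" where
  "max_quadratic I h x = max_linear I h x + (norm x)\<^sup>2 / 2"

lemma max_linear_ge: "finite I \<Longrightarrow> i \<in> I \<Longrightarrow> h i \<bullet> x \<le> max_linear I h x"
  unfolding max_linear_def by simp

lemma max_linear_attained:
  assumes "finite I" "I \<noteq> {}"
  obtains i where "i \<in> I" "max_linear I h x = h i \<bullet> x"
proof -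
  have "max_linear I h x \<in> (\<lambda>i. h i \<bullet> x) ` I"
    unfolding max_linear_def using assms by (intro Max_in) auto
  then show ?thesis
    using that by auto
qed

lemma max_linear_convex:
  assumes "finite I" "I \<noteq> {}" "convex X"
  shows "convex_on X (max_linear I h)"
proof (intro convex_onI)
  fix t :: real and x y
  assume t: "0 < t" "t < 1"
  obtain i where i: "i \<in> I" "max_linear I h ((1 - t) *\<^sub>R x + t *\<^sub>R y) = h i \<bullet> ((1 - t) *\<^sub>R x + t *\<^sub>R y)"
    using max_linear_attained[OF assms(1,2)] by metis
  have "(1 - t) * (h i \<bullet> x) + t * (h i \<bullet> y) \<le> (1 - t) * max_linear I h x + t * max_linear I h y"
    using t max_linear_ge[OF assms(1) i(1)] by (intro add_mono mult_left_mono) auto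
  then show "max_linear I h ((1 - t) *\<^sub>R x + t *\<^sub>R y)
      \<le> (1 - t) * max_linear I h x + t * max_linear I h y"
    using i(2) by (simp add: inner_add_right)
qed (use assms in simp)

text \<open>An index attaining the maximum at \<open>x\<close> still competes at \<open>y\<close>,
  so Cauchy-Schwarz bounds the difference.\<close>

lemma max_linear_lipschitz:
  assumes "finite I" "I \<noteq> {}" and L: "\<And>i. i \<in> I \<Longrightarrow> norm (h i) \<le> L"
  shows "L-lipschitz_on X (max_linear I h)"
proof (intro lipschitz_onI)
  have *: "max_linear I h x - max_linear I h y \<le> L * dist x y" for x y
  proof -
    obtain i where i: "i \<in> I" "max_linear I h x = h i \<bullet> x"
      using max_linear_attained[OF assms(1,2)] by metis
    have "max_linear I h x - max_linear I h y \<le> h i \<bullet> (x - y)"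
      using max_linear_ge[OF assms(1) i(1), of h y] i(2) by (simp add: inner_diff_right)
    also have "\<dots> \<le> norm (h i) * norm (x - y)"
      by (rule norm_cauchy_schwarz)
    also have "\<dots> \<le> L * dist x y"
      unfolding dist_norm using L[OF i(1)] by (intro mult_right_mono) auto
    finally show ?thesis .
  qed
  show "dist (max_linear I h x) (max_linear I h y) \<le> L * dist x y" for x y
    using *[of x y] *[of y x] by (simp add: dist_real_def dist_commute abs_le_iff)
  show "0 \<le> L"
    using assms by (metis ex_in_conv norm_ge_zero order_trans)
qed

lemma half_norm_square_lipschitz:
  fixes X :: "'a::real_inner set"
  assumes "\<And>x. x \<in> X \<Longrightarrow> norm x \<le> 1"
  shows "1-lipschitz_on X (\<lambda>x. (norm x)\<^sup>2 / 2)"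
proof (intro lipschitz_onI)
  fix x y assume "x \<in> X" "y \<in> X"
  then have "norm x + norm y \<le> 2"
    using assms[of x] assms[of y] by linarith
  then have "\<bar>norm x - norm y\<bar> * \<bar>norm x + norm y\<bar> \<le> norm (x - y) * 2"
    by (intro mult_mono norm_triangle_ineq3) auto
  moreover have "(norm x)\<^sup>2 / 2 - (norm y)\<^sup>2 / 2 = (norm x - norm y) * (norm x + norm y) / 2"
    by (simp add: power2_eq_square algebra_simps)
  ultimately show "dist ((norm x)\<^sup>2 / 2) ((norm y)\<^sup>2 / 2) \<le> 1 * dist x y"
    unfolding dist_real_def dist_norm by (simp only: abs_mult abs_divide)
qed simp

lemma max_quadratic_strongly_convex:
  assumes "finite I" "I \<noteq> {}" "convex X"
  shows "strongly_convex_on 1 X (max_quadratic I h)"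
  using max_linear_convex[OF assms, of h]
  by (intro strongly_convex_onI) (simp add: max_quadratic_def)

lemma max_quadratic_convex:
  fixes X :: "'a::real_inner set"
  assumes "finite I" "I \<noteq> {}" "convex X"
  shows "convex_on X (max_quadratic I h)"
proof -
  have "convex_on X (\<lambda>x::'a. (norm x)\<^sup>2 / 2)"
  proof (intro convex_onI)
    fix t :: real and x y :: 'a
    assume t: "0 < t" "t < 1"
    have "0 \<le> t * (1 - t) * (norm (y - x))\<^sup>2"
      using t by simp
    then show "(norm ((1 - t) *\<^sub>R x + t *\<^sub>R y))\<^sup>2 / 2
        \<le> (1 - t) * ((norm x)\<^sup>2 / 2) + t * ((norm y)\<^sup>2 / 2)"
      unfolding norm_convex_combination_square by simp
  qed (use assms in simp)
  then show ?thesis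
    unfolding max_quadratic_def using max_linear_convex[OF assms, of h]
    by (intro convex_on_add) auto
qed

lemma max_quadratic_lipschitz:
  assumes "finite I" "I \<noteq> {}" "\<And>i. i \<in> I \<Longrightarrow> norm (h i) \<le> L"
    and "\<And>x. x \<in> X \<Longrightarrow> norm x \<le> 1"
  shows "(L + 1)-lipschitz_on X (max_quadratic I h)"
  unfolding max_quadratic_def
  by (intro lipschitz_on_add max_linear_lipschitz half_norm_square_lipschitz assms)

text \<open>An active \<open>h i\<close> is a subgradient of the maximum, and \<open>x\<close> is
  the gradient of the quadratic term.\<close>

lemma max_quadratic_subgradient:
  assumes "finite I" "i \<in> I" "max_linear I h x = h i \<bullet> x"
  shows "h i + x \<in> subdifferential X (max_quadratic I h) x"
  unfolding subdifferential_def
proof (intro CollectI ballI)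
  fix y
  have "(norm y)\<^sup>2 / 2 - (norm x)\<^sup>2 / 2 - x \<bullet> (y - x) = (norm (y - x))\<^sup>2 / 2"
    unfolding power2_norm_eq_inner by (simp add: inner_diff inner_commute field_simps)
  moreover have "0 \<le> (norm (y - x))\<^sup>2 / 2"
    by simp
  ultimately have "x \<bullet> (y - x) \<le> (norm y)\<^sup>2 / 2 - (norm x)\<^sup>2 / 2"
    by linarith
  moreover have "h i \<bullet> y \<le> max_linear I h y"
    using assms by (intro max_linear_ge)
  ultimately show "(h i + x) \<bullet> (y - x) \<le> max_quadratic I h y - max_quadratic I h x"
    unfolding max_quadratic_def assms(3) by (simp add: inner_add_left inner_diff_right)
qed

lemma max_linear_eqI:
  assumes "finite I" "i \<in> I" "\<And>k. k \<in> I \<Longrightarrow> h k \<bullet> x \<le> h i \<bullet> x"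
  shows "max_linear I h x = h i \<bullet> x"
  unfolding max_linear_def using assms by (intro Max_eqI) auto

section \<open>The hard instance\<close>

lemma sum_inverse_squares_le: "(\<Sum>m=1..n. 1 / (real m)\<^sup>2) \<le> 2"
proof -
  \<comment> \<open>The slack \<open>1 / real (Suc n)\<close> makes the induction telescope.\<close>
  have "(\<Sum>m=1..Suc n. 1 / (real m)\<^sup>2) \<le> 2 - 1 / real (Suc n)" for n
  proof (induction n)
    case (Suc n)
    have "1 / (real (Suc (Suc n)))\<^sup>2 \<le> 1 / real (Suc n) - 1 / real (Suc (Suc n))"
      by (simp add: divide_simps power2_eq_square)
    then show ?case
      using Suc by simp
  qed simp
  from this[of "n - 1"] show ?thesis
    by (cases n) (auto intro: order_trans)
qed

text \<open>The construction is triangular in the coordinates, but \<open>'n\<close> carries no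
  order; \<open>p\<close> numbers them.\<close>

locale hard_instance =
  fixes p :: "'n::finite \<Rightarrow> nat" and d :: nat
  assumes p: "bij_betw p UNIV {1..d}"
begin

text \<open>Small enough that the at most \<open>d - m\<close> later subtractions at coordinate
  \<open>m\<close> remove less than half of its unit gain, yet large enough to sum to half a
  harmonic number.\<close>

definition a :: "nat \<Rightarrow> real" where
  "a m = 1 / (2 * real (d + 1 - m))"

definition h :: "nat \<Rightarrow> real ^ 'n" where
  "h i = (\<chi> j. if p j < i then a (p j) else if p j = i then - 1 else 0)"

text \<open>The closed form of \<open>- (\<Sum>i\<le>k. h i)\<close>.\<close>

definition W :: "nat \<Rightarrow> real ^ 'n" where
  "W k = (\<chi> j. if p j \<le> k then 1 - real (k - p j) * a (p j) else 0)"

lemma p_range: "1 \<le> p j" "p j \<le> d"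
  using bij_betw_apply[OF p, of j] by auto

lemma sum_p: "(\<Sum>j\<in>UNIV. F (p j)) = (\<Sum>m=1..d. F m)"
  using sum.reindex_bij_betw[OF p] .

lemma sum_p_rev: "(\<Sum>j\<in>UNIV. F (d + 1 - p j)) = (\<Sum>m=1..d. F m)"
  using sum_p[of "\<lambda>m. F (d + 1 - m)"] sum.atLeastAtMost_rev[of F 1 d] by simp

lemma a_nonneg: "0 \<le> a m"
  by (simp add: a_def)

lemma h_0: "h 0 = 0"
  unfolding h_def using p_range by (auto simp: vec_eq_iff Suc_le_eq)

lemma W_0: "W 0 = 0"
  unfolding W_def using p_range by (auto simp: vec_eq_iff Suc_le_eq)

lemma W_Suc: "W (Suc k) = W k - h (Suc k)"
  unfolding W_def h_def by (auto simp: vec_eq_iff Suc_diff_le algebra_simps le_Suc_eq)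

section \<open>Bounds on the partial sums and on the vectors\<close>

lemma W_ge_half:
  assumes "k \<le> d" "p j \<le> k"
  shows "1 / 2 \<le> W k $ j"
proof -
  have "real (k - p j) * a (p j) \<le> 1 / 2"
    unfolding a_def using assms by (simp add: divide_simps)
  then show ?thesis
    using assms by (simp add: W_def)
qed

lemma W_nonneg: "k \<le> d \<Longrightarrow> 0 \<le> W k $ j"
  using W_ge_half[of k j] by (cases "p j \<le> k") (auto simp: W_def)

text \<open>Only \<open>k\<close> coordinates are nonzero, each in [0,1]. This keeps the unprojected
  steps inside the ball.\<close>

lemma norm_W_le: "k \<le> d \<Longrightarrow> norm (W k) \<le> real k"
proof -
  assume k: "k \<le> d"
  have "norm (W k) \<le> (\<Sum>j\<in>UNIV. \<bar>W k $ j\<bar>)"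
    by (rule norm_le_l1_cart)
  also have "\<dots> \<le> (\<Sum>j\<in>UNIV. if p j \<le> k then 1 else 0)"
  proof (intro sum_mono)
    fix j
    have "W k $ j \<le> (if p j \<le> k then 1 else 0)"
      using a_nonneg[of "p j"] by (simp add: W_def)
    then show "\<bar>W k $ j\<bar> \<le> (if p j \<le> k then 1 else 0)"
      using W_nonneg[OF k, of j] by simp
  qed
  also have "\<dots> = (\<Sum>m=1..d. if m \<le> k then 1 else 0)"
    by (rule sum_p)
  also have "\<dots> = real (card {m \<in> {1..d}. m \<le> k})"
    by (simp flip: sum.inter_filter)
  also have "{m \<in> {1..d}. m \<le> k} = {1..k}"
    using k by auto
  finally show ?thesis
    by simp
qed

lemma norm_h_le: "norm (h i) \<le> 2"
proof -
  have "(norm (h i))\<^sup>2 = (\<Sum>j\<in>UNIV. (h i $ j)\<^sup>2)"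
    unfolding power2_norm_eq_inner by (simp add: inner_vec_def power2_eq_square)
  \<comment> \<open>The indicator pays for the entry \<open>-1\<close>; the other term bounds the
    squared \<open>a (p j)\<close>, dropping a factor 1/4.\<close>
  also have "\<dots> \<le> (\<Sum>j\<in>UNIV. 1 / (real (d + 1 - p j))\<^sup>2 + (if p j = i then 1 else 0))"
    by (intro sum_mono) (auto simp: h_def a_def power_divide power_mult_distrib divide_simps)
  also have "\<dots> = (\<Sum>m=1..d. 1 / (real m)\<^sup>2) + (\<Sum>m=1..d. if m = i then 1 else 0)"
    using sum_p_rev[of "\<lambda>m. 1 / (real m)\<^sup>2"] sum_p[of "\<lambda>m. if m = i then 1 else 0 :: real"]
    by (simp add: sum.distrib)
  also have "\<dots> \<le> 2 + 1"
    by (intro add_mono sum_inverse_squares_le) simp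
  also have "\<dots> \<le> (2::real)\<^sup>2"
    by simp
  finally show ?thesis
    by (rule power2_le_imp_le) simp
qed

text \<open>The comparison holds coordinatewise: where \<open>W k\<close> is nonzero,
  \<open>h (Suc k)\<close> has entry \<open>a (p j)\<close>, the largest any \<open>h i\<close> has
  there.\<close>

lemma inner_h_W_le:
  assumes "k \<le> d"
  shows "h i \<bullet> W k \<le> h (Suc k) \<bullet> W k"
  unfolding inner_vec_def
proof (intro sum_mono)
  fix j
  have "h i $ j \<le> h (Suc k) $ j" if "p j \<le> k"
    using that a_nonneg[of "p j"] by (auto simp: h_def)
  then show "h i $ j \<bullet> W k $ j \<le> h (Suc k) $ j \<bullet> W k $ j"
    using W_nonneg[OF assms, of j] by (cases "p j \<le> k") (auto simp: W_def intro: mult_right_mono)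
qed

lemma inner_h_W_final: "ln (real d) \<le> 4 * (h (Suc d) \<bullet> W d)"
proof -
  have "ln (real d) \<le> ln (real (Suc d))"
    \<comment> \<open>The index type is inhabited, which forces \<open>d\<close> to be
      positive.\<close>
    using p_range[of undefined] by simp
  also have "\<dots> \<le> harm d"
    using ln_le_harm[of d] by (simp add: add.commute)
  also have "\<dots> = (\<Sum>j\<in>UNIV. inverse (real (d + 1 - p j)))"
    unfolding harm_def by (rule sum_p_rev[symmetric])
  also have "\<dots> \<le> (\<Sum>j\<in>UNIV. 4 * (h (Suc d) $ j * W d $ j))"
  proof (intro sum_mono)
    fix j
    have "inverse (real (d + 1 - p j)) = 4 * (a (p j) * (1 / 2))"
      by (simp add: a_def inverse_eq_divide)
    also have "\<dots> \<le> 4 * (a (p j) * W d $ j)"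
      using W_ge_half[of d j] p_range[of j] a_nonneg by (intro mult_left_mono) auto
    finally show "inverse (real (d + 1 - p j)) \<le> 4 * (h (Suc d) $ j * W d $ j)"
      using p_range(2)[of j] by (simp add: h_def)
  qed
  finally show ?thesis
    by (simp add: inner_vec_def sum_distrib_left)
qed

section \<open>Objective, oracle and trajectory\<close>

definition f :: "real ^ 'n \<Rightarrow> real" where
  "f = max_quadratic {..Suc d} h"

text \<open>The test and the arbitrary fallback make this a valid oracle on the whole ball, also
  where \<open>h i\<close> is not active.\<close>

definition G :: "nat \<Rightarrow> nat \<Rightarrow> real ^ 'n \<Rightarrow> real ^ 'n" where
  "G T t x = (let i = t - (T - d) in
     if h i + x \<in> subdifferential (cball 0 1) f x then h i + x
     else SOME g. g \<in> subdifferential (cball 0 1) f x)"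

text \<open>The zero functional \<open>h 0\<close> takes part in the maximum.\<close>

lemma f_nonneg: "0 \<le> f x"
  using max_linear_ge[of "{..Suc d}" 0 h x] by (simp add: f_def max_quadratic_def h_0)

lemma f_0: "f 0 = 0"
  using max_linear_attained[of "{..Suc d}" h 0] by (auto simp: f_def max_quadratic_def)

lemma oracle_G: "subgradient_oracle (cball 0 1) f (G T)"
  unfolding subgradient_oracle_def
proof (intro allI impI ballI)
  fix t x
  obtain i where "i \<in> {..Suc d}" "max_linear {..Suc d} h x = h i \<bullet> x"
    using max_linear_attained[of "{..Suc d}" h x] by auto
  then have "h i + x \<in> subdifferential (cball 0 1) f x"
    unfolding f_def by (intro max_quadratic_subgradient) auto
  then show "G T t x \<in> subdifferential (cball 0 1) f x"
    unfolding G_def Let_def by (auto intro: someI)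
qed

text \<open>For \<open>t = 0\<close> the right-hand side is \<open>0\<close>, the initial point; for \<open>t \<le> T - d\<close> the truncated
  subtraction makes it \<open>0\<close> as well.\<close>

lemma psgd_eq:
  assumes "d \<le> T" "t \<le> T"
  shows "psgd (cball 0 1) (G T) (\<lambda>t. 1 / real t) 0 (Suc t) = (1 / real t) *\<^sub>R W (t - (T - d))"
  using assms(2)
proof (induction t)
  case (Suc t)
  define k where "k = t - (T - d)"
  define i where "i = Suc t - (T - d)"
  define x where "x = (1 / real t) *\<^sub>R W k"
  have k: "k \<le> d" and i: "i \<le> d" "i \<le> Suc t"
    using Suc.prems assms(1) by (auto simp: k_def i_def)
  have W_i: "W i = W k - h i" and i_active: "h m \<bullet> W k \<le> h i \<bullet> W k" for m
  proof -
    \<comment> \<open>Either the next vector is used, or the oracle is still idling at the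
      origin.\<close>
    consider "i = Suc k" | "i = 0" "k = 0"
      unfolding i_def k_def by linarith
    then show "W i = W k - h i" "h m \<bullet> W k \<le> h i \<bullet> W k"
      using inner_h_W_le[OF k] by (cases; simp add: W_Suc W_0 h_0)+
  qed
  have "h m \<bullet> x \<le> h i \<bullet> x" for m
    unfolding x_def using i_active[of m] by (simp add: divide_right_mono)
  then have "max_linear {..Suc d} h x = h i \<bullet> x"
    using i by (intro max_linear_eqI) auto
  then have "h i + x \<in> subdifferential (cball 0 1) f x"
    unfolding f_def using i by (intro max_quadratic_subgradient) auto
  then have G: "G T (Suc t) x = h i + x"
    unfolding G_def i_def by simp
  \<comment> \<open>At \<open>t = 0\<close> division by zero gives \<open>x = 0\<close>, in
    agreement with \<open>W 0 = 0\<close>.\<close>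
  have t_x: "real t *\<^sub>R x = W k"
    unfolding x_def by (cases "t = 0") (simp_all add: k_def W_0)
  \<comment> \<open>The part \<open>x\<close> of the answer turns the factor \<open>Suc t\<close>
    into \<open>t\<close>, so the scaled iterates just accumulate the \<open>- h i\<close>.\<close>
  have "real (Suc t) *\<^sub>R (x - (1 / real (Suc t)) *\<^sub>R (h i + x)) = real t *\<^sub>R x - h i"
    by (simp add: algebra_simps)
  also have "\<dots> = W i"
    by (simp add: t_x W_i)
  finally have step: "x - (1 / real (Suc t)) *\<^sub>R (h i + x) = (1 / real (Suc t)) *\<^sub>R W i"
    by (metis divide_inverse inverse_eq_divide mult_1 scaleR_scaleR left_inverse of_nat_neq_0 scaleR_one)
  \<comment> \<open>Hence the projection acts as the identity.\<close>
  have "norm (W i) \<le> real (Suc t)"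
    using norm_W_le[OF i(1)] i(2) by linarith
  then have "(1 / real (Suc t)) *\<^sub>R W i \<in> cball 0 1"
    by (simp add: divide_simps)
  then have "closest_point (cball 0 1) (x - (1 / real (Suc t)) *\<^sub>R G T (Suc t) x)
      = (1 / real (Suc t)) *\<^sub>R W i"
    unfolding G step by (rule closest_point_self)
  then show ?case
    using Suc by (simp add: Let_def x_def k_def i_def)
qed (simp add: W_0)

lemma f_last_iterate_ge:
  assumes "1 \<le> d" "d \<le> T"
  shows "ln (real d) / (5 * real T) \<le> f (psgd (cball 0 1) (G T) (\<lambda>t. 1 / real t) 0 (T + 1))"
proof -
  define x where "x = psgd (cball 0 1) (G T) (\<lambda>t. 1 / real t) 0 (T + 1)"
  have x: "x = (1 / real T) *\<^sub>R W d"
    using psgd_eq[OF assms(2), of T] assms(2) by (simp add: x_def)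
  have "ln (real d) / (5 * real T) \<le> ln (real d) / (4 * real T)"
    using assms by (intro divide_left_mono) auto
  also have "\<dots> \<le> h (Suc d) \<bullet> x"
    using inner_h_W_final assms by (simp add: x field_simps)
  \<comment> \<open>The vector \<open>h (Suc d)\<close>, never prescribed in the \<open>T\<close>
    steps, bounds the maximum from below; the quadratic term is dropped.\<close>
  also have "\<dots> \<le> f x"
    using max_linear_ge[of "{..Suc d}" "Suc d" h x] by (simp add: f_def max_quadratic_def add_increasing2)
  finally show ?thesis
    unfolding x_def .
qed

end

theorem theorem3p1:
  fixes T d :: nat and X :: "(real ^ 'n) set"
  assumes "CARD('n) = d" and "1 \<le> d" and "d \<le> T"
    and "X = {x. norm x \<le> 1}"
  shows "\<exists>(f :: real ^ 'n \<Rightarrow> real) (G :: nat \<Rightarrow> real ^ 'n \<Rightarrow> real ^ 'n).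
           convex_on X f \<and> 3-lipschitz_on X f \<and> strongly_convex_on 1 X f \<and>
           is_arg_min f (\<lambda>x. x \<in> X) 0 \<and>
           subgradient_oracle X f G \<and>
           f (psgd X G (\<lambda>t. 1 / real t) 0 (T + 1)) - (INF x\<in>X. f x) \<ge> ln (real d) / (5 * real T)"
proof -
  obtain p :: "'n \<Rightarrow> nat" where "bij_betw p UNIV {1..d}"
    using finite_same_card_bij[of "UNIV :: 'n set" "{1..d}"] assms(1) by auto
  then interpret hard_instance p d
    by unfold_locales
  have X: "X = cball 0 1"
    using assms(4) by auto
  \<comment> \<open>2 comes from the norms of the \<open>h i\<close>, 1 from the quadratic term on
    the unit ball.\<close>
  have "(2 + 1)-lipschitz_on X f"
    unfolding f_def X by (intro max_quadratic_lipschitz norm_h_le) auto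
  moreover have "convex_on X f" "strongly_convex_on 1 X f"
    unfolding f_def X by (auto intro: max_quadratic_convex max_quadratic_strongly_convex)
  moreover have "is_arg_min f (\<lambda>x. x \<in> X) 0"
    using f_nonneg by (simp add: is_arg_min_linorder X f_0)
  moreover have "(INF x\<in>X. f x) = 0"
  proof (rule cInf_eq_minimum)
    show "0 \<in> f ` X"
      by (rule image_eqI[of _ _ 0]) (auto simp: X f_0)
  qed (use f_nonneg in auto)
  ultimately show ?thesis
    using f_last_iterate_ge[OF assms(2,3)] oracle_G[of T]
    by (intro exI[of _ f] exI[of _ "G T"]) (simp add: X)
qed

end
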